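(* For every integer $p \geq 3$, $$c(C_p) = \binom{2^{2p}}{2}\, |B_{2p}|,$$ where $B_{2p}$ is the $2p$-th Bernoulli number.
   Context: Graphs are finite, simple and undirected. The elements of a graph $G=(V,E)$ are the members of $V \cup E$. A construction sequence (c-sequence) for $G$ is a listing of all the elements of $G$, without repetitions, such that each edge appears after both of its endpoints. The construction number $c(G)$ is the number of distinct construction sequences for $G$. $C_p$ is the cycle graph with $p$ vertices. Bernoulli numbers are the standard ones, with $\frac{t}{e^t-1} = \sum_{m\ge 0} B_m \frac{t^m}{m!}$. *)

theory Defs
  imports "HOL-Computational_Algebra.Formal_Power_Series"
begin

type_synonym 'a graph = "'a set \<times> 'a set set"

definition simple_graph :: "'a graph \<Rightarrow> bool" where
  "simple_graph G \<longleftrightarrow> finite (fst G) \<and> (\<forall>e\<in>snd G. e \<subseteq> fst G \<and> card e = 2)"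

text \<open>The sum type keeps vertices and edges apart, whatever the vertex type is.\<close>

definition elements :: "'a graph \<Rightarrow> ('a + 'a set) set" where
  "elements G = fst G <+> snd G"

definition construction_sequence :: "'a graph \<Rightarrow> ('a + 'a set) list \<Rightarrow> bool" where
  "construction_sequence G xs \<longleftrightarrow>
     distinct xs \<and> set xs = elements G \<and>
     (\<forall>i<length xs. \<forall>j<length xs. \<forall>v e.
        xs ! i = Inl v \<longrightarrow> xs ! j = Inr e \<longrightarrow> v \<in> e \<longrightarrow> i < j)"

definition construction_number :: "'a graph \<Rightarrow> nat" where
  "construction_number G = card {xs. construction_sequence G xs}"

text \<open>A cycle in the sense of simple graphs only for \<open>p \<ge> 3\<close>.\<close>

definition cycle_graph :: "nat \<Rightarrow> nat graph" where
  "cycle_graph p = ({..<p}, {{i, Suc i mod p} |i. i < p})"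

definition bernoulli :: "nat \<Rightarrow> real" where
  "bernoulli m = fact m * fps_nth (fps_X / (fps_exp 1 - 1)) m"

lemma simple_graph_cycle_graph:
  assumes "p \<ge> 3"
  shows "simple_graph (cycle_graph p)"
proof -
  have "Suc i mod p \<noteq> i" if "i < p" for i
    using that assms by (cases "Suc i = p") auto
  then show ?thesis
    using assms by (force simp: simple_graph_def cycle_graph_def card_2_iff)
qed

text \<open>\<open>construction_number\<close> counts a finite set.\<close>

lemma finite_construction_sequences:
  assumes "simple_graph G"
  shows "finite {xs. construction_sequence G xs}"
proof -
  have "snd G \<subseteq> Pow (fst G)"
    using assms by (auto simp: simple_graph_def)
  then have "finite (elements G)"
    using assms by (auto simp: elements_def simple_graph_def intro: finite_subset)
  then have "finite {xs. set xs \<subseteq> elements G \<and> distinct xs}"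
    by (rule finite_subset_distinct)
  then show ?thesis
    by (rule rev_finite_subset) (auto simp: construction_sequence_def)
qed

text \<open>The division of power series in \<open>bernoulli\<close> is exact.\<close>

lemma bernoulli_egf:
  "Abs_fps (\<lambda>m. bernoulli m / fact m) * (fps_exp 1 - 1) = fps_X"
proof -
  have "fps_nth (fps_exp 1 - 1 :: real fps) 1 \<noteq> 0" "fps_nth (fps_exp 1 - 1 :: real fps) 0 = 0"
    by simp_all
  then have "subdegree (fps_exp 1 - 1 :: real fps) = 1"
    by (intro subdegreeI) auto
  moreover have "(fps_exp 1 - 1 :: real fps) \<noteq> 0"
    using calculation by auto
  ultimately have "(fps_exp 1 - 1 :: real fps) dvd fps_X"
    by (simp add: fps_dvd_iff)
  moreover have "Abs_fps (\<lambda>m. bernoulli m / fact m) = fps_X / (fps_exp 1 - 1)"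
    by (simp add: fps_eq_iff bernoulli_def)
  ultimately show ?thesis
    by simp
qed

end

theory Submission
  imports Defs
begin

text \<open>
  The last entry of a construction sequence for a graph without isolated vertices is an edge, and
  removing it leaves a construction sequence for the graph with that edge deleted; so the
  construction number is the sum of those of the edge-deleted graphs
  (\<open>construction_number_delete_edge\<close>).  Deleting any of the \<open>p\<close> edges of the cycle leaves a path on
  \<open>p\<close> vertices.  Deleting an edge of a path leaves two disjoint shorter paths, whose construction
  sequences may be shuffled freely, which contributes a binomial coefficient
  (\<open>construction_number_disjoint_Un\<close>).  With \<open>T n\<close> the construction number of a path on \<open>n + 1\<close>
  vertices, this gives \<open>T 0 = 1\<close> and
  \<open>T (n + 1) = (\<Sum>i\<le>n. (2n + 2 choose 2i + 1) * T i * T (n - i))\<close>.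

  The recurrence says that \<open>y = (\<Sum>n. T n * x^(2n + 1) / (2n + 1)!)\<close> satisfies \<open>y' = 1 + y\<^sup>2\<close>, so
  \<open>y\<close> is the tangent and the \<open>T n\<close> are the tangent numbers.  To stay over the reals, the signs are
  twisted to give \<open>t' = 1 - t\<^sup>2\<close>, which forces \<open>t * (exp (2x) + 1) = exp (2x) - 1\<close>
  (\<open>tanh_fps_exp\<close>).  If \<open>b(x) = x / (exp x - 1)\<close> generates the Bernoulli numbers, then
  \<open>x * t = x - b(2x) + b(4x)\<close> (\<open>fps_X_mult_tanh_fps\<close>), and the coefficient of \<open>x^(2p)\<close> expresses
  \<open>T (p - 1)\<close>, up to sign, as \<open>2^(2p) * (2^(2p) - 1) * B(2p) / (2p)\<close>.  Multiplied by \<open>p\<close>, this is the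
  claim.
\<close>

section \<open>Listings subject to a precedence relation\<close>

definition listings :: "('a \<Rightarrow> 'a \<Rightarrow> bool) \<Rightarrow> 'a set \<Rightarrow> 'a list set" where
  "listings R A = {xs. distinct xs \<and> set xs = A \<and> sorted_wrt R xs}"

lemma finite_listings:
  assumes "finite A"
  shows "finite (listings R A)"
  by (rule finite_subset[OF _ finite_subset_distinct[OF assms]]) (auto simp: listings_def)

lemma length_listings: "xs \<in> listings R A \<Longrightarrow> length xs = card A"
  by (auto simp: listings_def distinct_card)

lemma sorted_wrt_shuffles:
  assumes "zs \<in> shuffles xs ys" "sorted_wrt R xs" "sorted_wrt R ys"
    and "\<And>x y. x \<in> set xs \<Longrightarrow> y \<in> set ys \<Longrightarrow> R x y \<and> R y x"
  shows "sorted_wrt R zs"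
  using assms
proof (induction zs arbitrary: xs ys)
  case Nil
  then show ?case by simp
next
  case (Cons z zs)
  from Cons.prems(1) consider
    xs' where "xs = z # xs'" "zs \<in> shuffles xs' ys" |
    ys' where "ys = z # ys'" "zs \<in> shuffles xs ys'"
    unfolding Cons_in_shuffles_iff by (metis list.collapse)
  then show ?case
  proof cases
    case 1
    with Cons.prems Cons.IH[of xs' ys] show ?thesis
      by (auto dest!: set_shuffles)
  next
    case 2
    with Cons.prems Cons.IH[of xs ys'] show ?thesis
      by (auto dest!: set_shuffles)
  qed
qed

lemma listings_Un:
  assumes disj: "A \<inter> B = {}"
    and R: "\<And>a b. a \<in> A \<Longrightarrow> b \<in> B \<Longrightarrow> R a b \<and> R b a"
  shows "listings R (A \<union> B) = (\<Union>(xs, ys)\<in>listings R A \<times> listings R B. shuffles xs ys)"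
    (is "_ = ?rhs")
proof (intro equalityI subsetI)
  fix zs assume "zs \<in> listings R (A \<union> B)"
  then have zs: "distinct zs" "set zs = A \<union> B" "sorted_wrt R zs"
    by (auto simp: listings_def)
  define xs ys where "xs = filter (\<lambda>z. z \<in> A) zs" and "ys = filter (\<lambda>z. z \<notin> A) zs"
  have "zs \<in> shuffles xs ys"
    unfolding xs_def ys_def by (rule partition_in_shuffles)
  moreover have "xs \<in> listings R A" "ys \<in> listings R B"
    using zs disj by (auto simp: xs_def ys_def listings_def intro: sorted_wrt_filter)
  ultimately show "zs \<in> ?rhs" by auto
next
  fix zs assume "zs \<in> ?rhs"
  then obtain xs ys where *: "xs \<in> listings R A" "ys \<in> listings R B" "zs \<in> shuffles xs ys"
    by auto
  then have "sorted_wrt R zs"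
    using R by (intro sorted_wrt_shuffles[of zs xs ys]) (auto simp: listings_def)
  moreover have "distinct zs" "set zs = A \<union> B"
    using * disj by (auto simp: listings_def set_shuffles intro: distinct_disjoint_shuffles)
  ultimately show "zs \<in> listings R (A \<union> B)"
    by (simp add: listings_def)
qed

text \<open>
  When \<open>R\<close> never constrains an element of \<open>A\<close> against one of \<open>B\<close>, the listings of the union are
  exactly the shuffles of a listing of \<open>A\<close> with one of \<open>B\<close>, and filtering by membership in \<open>A\<close>
  recovers both, so nothing is counted twice.
\<close>

lemma card_listings_Un:
  assumes fin: "finite A" "finite B" and disj: "A \<inter> B = {}"
    and R: "\<And>a b. a \<in> A \<Longrightarrow> b \<in> B \<Longrightarrow> R a b \<and> R b a"
  shows "card (listings R (A \<union> B)) =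
    (card A + card B choose card A) * card (listings R A) * card (listings R B)"
proof -
  let ?P = "listings R A \<times> listings R B"
  have decode: "filter (\<lambda>z. z \<in> A) zs = xs \<and> filter (\<lambda>z. z \<notin> A) zs = ys"
    if "(xs, ys) \<in> ?P" "zs \<in> shuffles xs ys" for xs ys zs
    using that disj filter_shuffles_disjoint1[of xs ys zs] by (auto simp: listings_def)
  have "listings R (A \<union> B) = (\<Union>(xs, ys)\<in>?P. shuffles xs ys)"
    by (rule listings_Un) (use disj R in auto)
  also have "card \<dots> = (\<Sum>p\<in>?P. card (case p of (xs, ys) \<Rightarrow> shuffles xs ys))"
  proof (rule card_UN_disjoint)
    show "\<forall>p\<in>?P. \<forall>q\<in>?P. p \<noteq> q \<longrightarrow>
      (case p of (xs, ys) \<Rightarrow> shuffles xs ys) \<inter> (case q of (xs, ys) \<Rightarrow> shuffles xs ys) = {}"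
    proof (intro ballI impI)
      fix p q assume "p \<in> ?P" "q \<in> ?P" "p \<noteq> q"
      moreover have "p = (filter (\<lambda>z. z \<in> A) zs, filter (\<lambda>z. z \<notin> A) zs)"
        if "p \<in> ?P" "zs \<in> (case p of (xs, ys) \<Rightarrow> shuffles xs ys)" for p zs
        using that decode[of "fst p" "snd p" zs] by (simp add: case_prod_beta)
      ultimately show "(case p of (xs, ys) \<Rightarrow> shuffles xs ys) \<inter> (case q of (xs, ys) \<Rightarrow> shuffles xs ys) = {}"
        by (metis disjoint_iff)
    qed
  qed (auto simp: finite_listings fin)
  also have "\<dots> = (\<Sum>p\<in>?P. (card A + card B choose card A))"
  proof (rule sum.cong[OF refl])
    fix p assume "p \<in> ?P"
    then obtain xs ys where p: "p = (xs, ys)" "xs \<in> listings R A" "ys \<in> listings R B"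
      by auto
    then have "set xs \<inter> set ys = {}"
      using disj by (auto simp: listings_def)
    then show "card (case p of (xs, ys) \<Rightarrow> shuffles xs ys) = (card A + card B choose card A)"
      using p by (simp add: card_disjoint_shuffles length_listings)
  qed
  finally show ?thesis
    by (simp add: card_cartesian_product)
qed

section \<open>Construction numbers\<close>

text \<open>
  Since a listing has no position in which an edge equals a vertex, the strict inequality of
  positions in a construction sequence only forbids an edge from standing before one of its own
  endpoints; this makes the condition one on ordered pairs of entries.
\<close>

definition may_precede :: "'a + 'a set \<Rightarrow> 'a + 'a set \<Rightarrow> bool" where
  "may_precede x y \<longleftrightarrow> \<not> (\<exists>v e. x = Inr e \<and> y = Inl v \<and> v \<in> e)"

lemma construction_sequences_eq_listings:
  "{xs. construction_sequence G xs} = listings may_precede (elements G)"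
proof -
  have "(\<forall>i<length xs. \<forall>j<length xs. \<forall>v e.
        xs ! i = Inl v \<longrightarrow> xs ! j = Inr e \<longrightarrow> v \<in> e \<longrightarrow> i < j) \<longleftrightarrow> sorted_wrt may_precede xs"
    (is "?L \<longleftrightarrow> ?R") for xs :: "('a + 'a set) list"
  proof
    assume L: ?L
    show ?R
      unfolding sorted_wrt_iff_nth_less may_precede_def
    proof (intro allI impI notI)
      fix i j assume ij: "i < j" "j < length xs"
        and "\<exists>v e. xs ! i = Inr e \<and> xs ! j = Inl v \<and> v \<in> e"
      then obtain v e where "xs ! i = Inr e" "xs ! j = Inl v" "v \<in> e"
        by blast
      with L[rule_format, of j i v e] ij show False
        by simp
    qed
  next
    assume R: ?R
    show ?L
    proof (intro allI impI)
      fix i j v e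
      assume *: "i < length xs" "j < length xs" "xs ! i = Inl v" "xs ! j = Inr e" "v \<in> e"
      then have "i \<noteq> j" by auto
      moreover have "\<not> j < i"
        using R * unfolding sorted_wrt_iff_nth_less may_precede_def by blast
      ultimately show "i < j" by simp
    qed
  qed
  then show ?thesis
    by (simp add: construction_sequence_def listings_def)
qed

lemma construction_number_eq_card_listings:
  "construction_number G = card (listings may_precede (elements G))"
  by (simp add: construction_number_def construction_sequences_eq_listings)

lemma finite_elements:
  assumes "simple_graph G"
  shows "finite (elements G)"
proof -
  have "snd G \<subseteq> Pow (fst G)"
    using assms by (auto simp: simple_graph_def)
  then show ?thesis
    using assms by (auto simp: elements_def simple_graph_def intro: finite_subset)
qed

lemma construction_number_disjoint_Un:
  assumes G: "simple_graph (V, E)" and H: "simple_graph (W, F)" and disj: "V \<inter> W = {}"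
  shows "construction_number (V \<union> W, E \<union> F) =
    (card V + card E + (card W + card F) choose (card V + card E)) *
      construction_number (V, E) * construction_number (W, F)"
proof -
  have sub: "E \<subseteq> Pow V" "F \<subseteq> Pow W"
    using G H by (auto simp: simple_graph_def)
  have fin: "finite V" "finite W"
    using G H by (auto simp: simple_graph_def)
  then have fin': "finite E" "finite F"
    using sub by (auto intro: finite_subset)
  have "{} \<notin> E"
    using G by (auto simp: simple_graph_def)
  moreover have "e = {}" if "e \<in> E" "e \<in> F" for e
  proof -
    have "e \<subseteq> V \<inter> W"
      using that sub by auto
    then show ?thesis
      using disj by simp
  qed
  ultimately have EF: "E \<inter> F = {}"
    by auto
  have union: "elements (V \<union> W, E \<union> F) = elements (V, E) \<union> elements (W, F)"
    by (auto simp: elements_def)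
  have card: "card (elements (V, E)) = card V + card E" "card (elements (W, F)) = card W + card F"
    using fin fin' by (simp_all add: elements_def card_Plus)
  have "card (listings may_precede (elements (V, E) \<union> elements (W, F))) =
    (card (elements (V, E)) + card (elements (W, F)) choose card (elements (V, E))) *
      card (listings may_precede (elements (V, E))) * card (listings may_precede (elements (W, F)))"
  proof (rule card_listings_Un)
    show "finite (elements (V, E))" "finite (elements (W, F))"
      using G H by (auto intro: finite_elements)
    show "elements (V, E) \<inter> elements (W, F) = {}"
      using disj EF by (auto simp: elements_def)
    show "may_precede a b \<and> may_precede b a"
      if "a \<in> elements (V, E)" "b \<in> elements (W, F)" for a b
    proof (cases a; cases b)
      fix v f assume "a = Inl v" "b = Inr f"
      with that have "v \<in> V" "f \<in> F" by (auto simp: elements_def)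
      then have "v \<notin> f" using sub disj by (meson PowD disjoint_iff subsetD)
      then show ?thesis using \<open>a = Inl v\<close> \<open>b = Inr f\<close> by (simp add: may_precede_def)
    next
      fix e w assume "a = Inr e" "b = Inl w"
      with that have "w \<in> W" "e \<in> E" by (auto simp: elements_def)
      then have "w \<notin> e" using sub disj by (meson PowD disjoint_iff subsetD)
      then show ?thesis using \<open>a = Inr e\<close> \<open>b = Inl w\<close> by (simp add: may_precede_def)
    qed (simp_all add: may_precede_def)
  qed
  then show ?thesis
    by (simp add: construction_number_eq_card_listings union card)
qed

text \<open>
  A vertex that lies on some edge has to precede it, so if every vertex is covered, the last entry
  is an edge.  Conversely an edge may always be appended, because nothing has to come after it.
\<close>

lemma construction_number_delete_edge:
  assumes G: "simple_graph (V, E)" and "V \<noteq> {}" and cover: "V \<subseteq> \<Union>E"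
  shows "construction_number (V, E) = (\<Sum>e\<in>E. construction_number (V, E - {e}))"
proof -
  let ?L = "\<lambda>e. listings may_precede (elements (V, E - {e}))"
  have sub: "E \<subseteq> Pow V"
    using G by (auto simp: simple_graph_def)
  have "finite V"
    using G by (auto simp: simple_graph_def)
  then have "finite E"
    using sub by (auto intro: finite_subset)
  have "listings may_precede (elements (V, E)) = (\<Union>e\<in>E. (\<lambda>xs. xs @ [Inr e]) ` ?L e)"
    (is "_ = ?rhs")
  proof (intro equalityI subsetI)
    fix xs assume "xs \<in> listings may_precede (elements (V, E))"
    then have xs: "distinct xs" "set xs = elements (V, E)" "sorted_wrt may_precede xs"
      by (auto simp: listings_def)
    have "xs \<noteq> []"
      using xs(2) \<open>V \<noteq> {}\<close> by (auto simp: elements_def)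
    then obtain ys z where ys: "xs = ys @ [z]"
      by (cases xs rule: rev_cases) auto
    have "z \<noteq> Inl v" for v
    proof
      assume z: "z = Inl v"
      then have "Inl v \<in> elements (V, E)"
        by (simp flip: xs(2) add: ys)
      then have "v \<in> V"
        by (auto simp: elements_def)
      then obtain e where e: "e \<in> E" "v \<in> e"
        using cover by blast
      then have "Inr e \<in> elements (V, E)"
        by (simp add: elements_def InrI)
      then have "Inr e \<in> set ys"
        by (simp flip: xs(2) add: ys z)
      moreover have "\<forall>y\<in>set ys. may_precede y (Inl v)"
        using xs(3) by (simp add: ys z sorted_wrt_append)
      ultimately show False
        using e(2) by (auto simp: may_precede_def)
    qed
    then obtain e where z: "z = Inr e"
      by (metis sum.exhaust)
    have "Inr e \<in> elements (V, E)"
      by (simp flip: xs(2) add: ys z)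
    then have "e \<in> E"
      by (auto simp: elements_def)
    moreover have "set ys = elements (V, E) - {Inr e}"
      using xs(1) by (simp flip: xs(2) add: ys z)
    then have "set ys = elements (V, E - {e})"
      by (auto simp: elements_def)
    then have "ys \<in> ?L e"
      using xs ys by (auto simp: listings_def sorted_wrt_append)
    ultimately show "xs \<in> ?rhs"
      using ys z by auto
  next
    fix xs assume "xs \<in> ?rhs"
    then obtain e ys where "e \<in> E" "ys \<in> ?L e" "xs = ys @ [Inr e]"
      by auto
    then show "xs \<in> listings may_precede (elements (V, E))"
      by (auto simp: listings_def sorted_wrt_append may_precede_def elements_def)
  qed
  then have "construction_number (V, E) = (\<Sum>e\<in>E. card ((\<lambda>xs. xs @ [Inr e]) ` ?L e))"
    unfolding construction_number_eq_card_listings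
    using \<open>finite E\<close> \<open>finite V\<close>
    by (simp, subst card_UN_disjoint) (auto simp: elements_def intro!: finite_listings)
  also have "\<dots> = (\<Sum>e\<in>E. construction_number (V, E - {e}))"
    by (simp add: construction_number_eq_card_listings card_image inj_on_def)
  finally show ?thesis .
qed

section \<open>Paths and cycles\<close>

text \<open>
  Describing a path by the list of its vertices makes the two pieces left by an edge deletion a
  prefix and a suffix of that list, and the induction below covers all paths of a given length at
  once, with no appeal to graph isomorphism.
\<close>

definition path_edges :: "'a list \<Rightarrow> 'a set set" where
  "path_edges vs = (\<lambda>i. {vs ! i, vs ! Suc i}) ` {..<length vs - 1}"

lemma inj_on_path_edges:
  assumes "distinct vs"
  shows "inj_on (\<lambda>i. {vs ! i, vs ! Suc i}) {..<length vs - 1}"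
proof (rule inj_onI)
  fix i j assume "i \<in> {..<length vs - 1}" "j \<in> {..<length vs - 1}"
    and "{vs ! i, vs ! Suc i} = {vs ! j, vs ! Suc j}"
  with assms show "i = j"
    by (auto simp: doubleton_eq_iff nth_eq_iff_index_eq)
qed

lemma simple_graph_path:
  assumes "distinct vs"
  shows "simple_graph (set vs, path_edges vs)"
  using assms by (auto simp: simple_graph_def path_edges_def card_insert_if nth_eq_iff_index_eq)

lemma card_path_edges: "distinct vs \<Longrightarrow> card (path_edges vs) = length vs - 1"
  using card_image[OF inj_on_path_edges[of vs]] by (simp add: path_edges_def)

lemma path_edges_delete:
  assumes "distinct vs" and i: "i < length vs - 1"
  shows "path_edges vs - {{vs ! i, vs ! Suc i}} =
    path_edges (take (Suc i) vs) \<union> path_edges (drop (Suc i) vs)"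
proof -
  let ?e = "\<lambda>i. {vs ! i, vs ! Suc i}"
  have "path_edges vs - {?e i} = ?e ` ({..<length vs - 1} - {i})"
    unfolding path_edges_def using inj_on_path_edges[OF assms(1)] i
    by (subst inj_on_image_set_diff[where C = "{..<length vs - 1}"]) auto
  also have "{..<length vs - 1} - {i} = {..<i} \<union> (\<lambda>j. Suc i + j) ` {..<length vs - 1 - Suc i}"
    (is "?A = ?B")
  proof (intro equalityI subsetI)
    fix k assume "k \<in> ?A"
    then show "k \<in> ?B"
      by (cases "k < i") (auto intro!: image_eqI[of _ _ "k - Suc i"])
  qed (use i in auto)
  also have "?e ` ?B = path_edges (take (Suc i) vs) \<union> path_edges (drop (Suc i) vs)"
    using i by (auto simp: path_edges_def image_Un image_image)
  finally show ?thesis .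
qed

text \<open>
  The value at \<open>n\<close> is the derivative of order \<open>2 * n + 1\<close> of the tangent function at zero:
  \<open>1, 2, 16, 272, \<dots>\<close>
\<close>

fun tangent_number :: "nat \<Rightarrow> nat" where
  "tangent_number 0 = 1"
| "tangent_number (Suc n) =
    (\<Sum>i\<le>n. (2 * n + 2 choose (2 * i + 1)) * tangent_number i * tangent_number (n - i))"

text \<open>
  Deleting the edge after position \<open>i\<close> leaves paths on \<open>i + 1\<close> and \<open>m - i + 1\<close> vertices.  They have
  \<open>2 * i + 1\<close> and \<open>2 * (m - i) + 1\<close> elements, which is where the odd lower indices of the
  binomial coefficients come from.
\<close>

lemma construction_number_path:
  assumes "distinct vs" "length vs = Suc n"
  shows "construction_number (set vs, path_edges vs) = tangent_number n"
  using assms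
proof (induction n arbitrary: vs rule: less_induct)
  case (less n)
  show ?case
  proof (cases n)
    case 0
    then obtain v where v: "vs = [v]"
      using less.prems by (cases vs) auto
    have "listings may_precede (elements ({v}, {})) = {[Inl v :: 'a + 'a set]}"
    proof (intro equalityI subsetI)
      fix xs :: "('a + 'a set) list"
      assume "xs \<in> listings may_precede (elements ({v}, {}))"
      then have xs: "set xs = {Inl v}" "length xs = 1"
        using distinct_card[of xs] by (auto simp: listings_def elements_def Plus_def)
      then show "xs \<in> {[Inl v]}"
        by (cases xs) auto
    qed (auto simp: listings_def elements_def)
    then show ?thesis
      using 0 v by (simp add: construction_number_eq_card_listings path_edges_def)
  next
    case (Suc m)
    let ?e = "\<lambda>i. {vs ! i, vs ! Suc i}"
    have cover: "set vs \<subseteq> \<Union>(path_edges vs)"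
    proof
      fix v assume "v \<in> set vs"
      then obtain i where i: "i < length vs" "v = vs ! i"
        by (metis in_set_conv_nth)
      show "v \<in> \<Union>(path_edges vs)"
      proof (cases "i = n")
        case True
        then show ?thesis
          using i Suc less.prems by (auto simp: path_edges_def intro!: bexI[of _ m])
      next
        case False
        then show ?thesis
          using i Suc less.prems by (auto simp: path_edges_def intro!: bexI[of _ i])
      qed
    qed
    have ne: "set vs \<noteq> {}"
      using less.prems by auto
    have "construction_number (set vs, path_edges vs) =
      (\<Sum>e\<in>path_edges vs. construction_number (set vs, path_edges vs - {e}))"
      using construction_number_delete_edge[OF simple_graph_path ne cover] less.prems by simp
    also have "\<dots> = (\<Sum>i\<le>m. construction_number (set vs, path_edges vs - {?e i}))"
      using sum.reindex[OF inj_on_path_edges[OF less.prems(1)],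
          of "\<lambda>e. construction_number (set vs, path_edges vs - {e})"] less.prems(2) Suc
      by (simp add: path_edges_def lessThan_Suc_atMost)
    also have "\<dots> = (\<Sum>i\<le>m. (2 * m + 2 choose (2 * i + 1)) * tangent_number i * tangent_number (m - i))"
    proof (rule sum.cong[OF refl])
      fix i assume "i \<in> {..m}"
      then have i: "i \<le> m" by simp
      let ?t = "take (Suc i) vs" and ?d = "drop (Suc i) vs"
      have dist: "distinct ?t" "distinct ?d" and len: "length ?t = Suc i" "length ?d = Suc (m - i)"
        using less.prems Suc i by auto
      have disj: "set ?t \<inter> set ?d = {}"
        using less.prems(1) by (simp add: set_take_disj_set_drop_if_distinct)
      have un: "set vs = set ?t \<union> set ?d"
        by (metis append_take_drop_id set_append)
      have "construction_number (set vs, path_edges vs - {?e i}) =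
        construction_number (set ?t \<union> set ?d, path_edges ?t \<union> path_edges ?d)"
        using path_edges_delete[OF less.prems(1), of i] i Suc less.prems(2) un by simp
      also have "\<dots> =
        (card (set ?t) + card (path_edges ?t) + (card (set ?d) + card (path_edges ?d))
          choose (card (set ?t) + card (path_edges ?t))) *
        construction_number (set ?t, path_edges ?t) * construction_number (set ?d, path_edges ?d)"
        by (rule construction_number_disjoint_Un[OF simple_graph_path simple_graph_path disj])
          (use dist in auto)
      also have "construction_number (set ?t, path_edges ?t) = tangent_number i"
        by (rule less.IH) (use dist len i Suc in auto)
      also have "construction_number (set ?d, path_edges ?d) = tangent_number (m - i)"
        by (rule less.IH) (use dist len i Suc in auto)
      also have "card (set ?t) + card (path_edges ?t) = 2 * i + 1"
        using dist(1) len(1) by (simp only: distinct_card card_path_edges)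
      also have "card (set ?d) + card (path_edges ?d) = 2 * (m - i) + 1"
        using dist(2) len(2) by (simp only: distinct_card card_path_edges)
      also have "2 * i + 1 + (2 * (m - i) + 1) = 2 * m + 2"
        using i by simp
      finally show "construction_number (set vs, path_edges vs - {?e i}) =
        (2 * m + 2 choose (2 * i + 1)) * tangent_number i * tangent_number (m - i)" .
    qed
    finally show ?thesis
      using Suc by simp
  qed
qed

text \<open>
  The cycle without the edge from \<open>i\<close> to its successor is the path that starts at that successor and
  runs once around, so its vertices are a rotation of \<open>0, \<dots>, p - 1\<close>.
\<close>

lemma construction_number_cycle:
  assumes p: "p \<ge> 3"
  shows "construction_number (cycle_graph p) = p * tangent_number (p - 1)"
proof -
  define e where "e = (\<lambda>i. {i, Suc i mod p})"
  have cycle: "cycle_graph p = ({..<p}, e ` {..<p})"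
    by (auto simp: cycle_graph_def e_def)
  have inj: "inj_on e {..<p}"
  proof (rule inj_onI)
    fix i j assume "i \<in> {..<p}" "j \<in> {..<p}" "e i = e j"
    with p show "i = j"
      by (auto simp: e_def doubleton_eq_iff mod_Suc split: if_splits)
  qed
  have "construction_number ({..<p}, e ` {..<p}) =
    (\<Sum>f\<in>e ` {..<p}. construction_number ({..<p}, e ` {..<p} - {f}))"
  proof (rule construction_number_delete_edge)
    show "simple_graph ({..<p}, e ` {..<p})"
      using simple_graph_cycle_graph[OF p] cycle by simp
    show "{..<p} \<noteq> {}" using p by (auto simp: lessThan_empty_iff)
    show "{..<p} \<subseteq> \<Union>(e ` {..<p})" by (auto simp: e_def)
  qed
  also have "\<dots> = (\<Sum>i<p. construction_number ({..<p}, e ` {..<p} - {e i}))"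
    using inj by (simp add: sum.reindex)
  also have "\<dots> = (\<Sum>i<p. tangent_number (p - 1))"
  proof (rule sum.cong[OF refl])
    fix i assume "i \<in> {..<p}"
    then have i: "i < p" by simp
    \<comment> \<open>The endpoint \<open>i\<close> of the deleted edge comes last, its successor first.\<close>
    define vs where "vs = rotate (Suc i) [0..<p]"
    have len: "length vs = p" and dist: "distinct vs" and set: "set vs = {..<p}"
      by (auto simp: vs_def)
    have nth: "vs ! j = (Suc i + j) mod p" if "j < p" for j
      using that by (simp add: vs_def nth_rotate del: rotate_Suc)
    have "path_edges vs = (\<lambda>j. e ((Suc i + j) mod p)) ` {..<p - 1}"
      unfolding path_edges_def len
    proof (rule image_cong[OF refl])
      fix j assume "j \<in> {..<p - 1}"
      then show "{vs ! j, vs ! Suc j} = e ((Suc i + j) mod p)"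
        by (simp add: nth e_def mod_Suc_eq)
    qed
    also have "\<dots> = e ` ((\<lambda>j. (Suc i + j) mod p) ` {..<p - 1})"
      by (simp add: image_image)
    also have "(\<lambda>j. (Suc i + j) mod p) ` {..<p - 1} = {..<p} - {i}"
    proof (intro equalityI subsetI)
      fix k assume "k \<in> (\<lambda>j. (Suc i + j) mod p) ` {..<p - 1}"
      then obtain j where j: "j < p - 1" "k = (Suc i + j) mod p" by auto
      then show "k \<in> {..<p} - {i}"
        using i p by (cases "Suc i + j < p") (auto simp: mod_if)
    next
      fix k assume k: "k \<in> {..<p} - {i}"
      show "k \<in> (\<lambda>j. (Suc i + j) mod p) ` {..<p - 1}"
      proof (cases "i < k")
        case True
        then show ?thesis
          using k i by (intro image_eqI[of _ _ "k - Suc i"]) auto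
      next
        case False
        then show ?thesis
          using k i by (intro image_eqI[of _ _ "k + p - Suc i"]) auto
      qed
    qed
    also have "e ` ({..<p} - {i}) = e ` {..<p} - {e i}"
      using inj i by (subst inj_on_image_set_diff[where C = "{..<p}"]) auto
    finally have edges: "e ` {..<p} - {e i} = path_edges vs" ..
    show "construction_number ({..<p}, e ` {..<p} - {e i}) = tangent_number (p - 1)"
      using construction_number_path[OF dist, of "p - 1"] p by (simp only: edges set len)
  qed
  finally show ?thesis
    by (simp add: cycle)
qed

section \<open>Tangent numbers and Bernoulli numbers\<close>

unbundle fps_syntax

text \<open>
  This is \<open>- \<i> tan (\<i> x)\<close> for the series of the tangent numbers; the alternating signs
  keep the exponentials needed to solve its differential equation real.
\<close>

definition tanh_fps :: "real fps" where
  "tanh_fps = Abs_fps (\<lambda>m. if odd m then (- 1) ^ (m div 2) * real (tangent_number (m div 2)) / fact m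
                           else 0)"

lemma tanh_fps_nth_odd:
  "tanh_fps $ (2 * n + 1) = (- 1) ^ n * real (tangent_number n) / fact (2 * n + 1)"
  by (simp add: tanh_fps_def)

lemma tanh_fps_nth_even: "even m \<Longrightarrow> tanh_fps $ m = 0"
  by (simp add: tanh_fps_def)

text \<open>
  In the square, only products of two odd-order coefficients survive, so odd orders vanish, and at
  order \<open>2 * n + 2\<close> the convolution is the recurrence of the tangent numbers divided by
  \<open>(2 * n + 2)!\<close>, with sign \<open>(- 1) ^ n\<close>.
\<close>

lemma fps_deriv_tanh_fps: "fps_deriv tanh_fps = 1 - tanh_fps\<^sup>2"
proof (rule fps_ext)
  fix m :: nat
  have "m = 2 * (m div 2 - 1) + 2" if "m \<noteq> 0" "even m"
    using that by (auto elim!: evenE)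
  then consider "m = 0" | "odd m" | n where "m = 2 * n + 2"
    by blast
  then show "fps_deriv tanh_fps $ m = (1 - tanh_fps\<^sup>2) $ m"
  proof cases
    case 1
    then show ?thesis
      using tanh_fps_nth_odd[of 0] by (simp add: power2_eq_square tanh_fps_nth_even)
  next
    case 2
    have "tanh_fps $ i * tanh_fps $ (m - i) = 0" if "i \<le> m" for i
      using that 2 by (cases "even i") (auto simp: tanh_fps_nth_even)
    then have "(tanh_fps\<^sup>2) $ m = 0"
      by (simp only: power2_eq_square fps_mult_nth) (rule sum.neutral, simp)
    then show ?thesis
      using 2 odd_pos[of m] by (simp add: tanh_fps_nth_even)
  next
    case (3 n)
    have "(tanh_fps\<^sup>2) $ m = (\<Sum>i=0..m. tanh_fps $ i * tanh_fps $ (m - i))"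
      by (simp add: power2_eq_square fps_mult_nth)
    also have "\<dots> = (\<Sum>i\<in>(\<lambda>i. 2 * i + 1) ` {..n}. tanh_fps $ i * tanh_fps $ (m - i))"
    proof (rule sum.mono_neutral_right)
      show "\<forall>i\<in>{0..m} - (\<lambda>i. 2 * i + 1) ` {..n}. tanh_fps $ i * tanh_fps $ (m - i) = 0"
      proof
        fix i assume i: "i \<in> {0..m} - (\<lambda>i. 2 * i + 1) ` {..n}"
        have "even i"
        proof (rule ccontr)
          assume "odd i"
          then obtain k where "i = 2 * k + 1" by (rule oddE)
          with i 3 show False by auto
        qed
        then show "tanh_fps $ i * tanh_fps $ (m - i) = 0"
          by (simp add: tanh_fps_nth_even)
      qed
    qed (use 3 in auto)
    also have "\<dots> = (\<Sum>i\<le>n. tanh_fps $ (2 * i + 1) * tanh_fps $ (m - (2 * i + 1)))"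
      by (subst sum.reindex) (auto simp: inj_on_def)
    also have "\<dots> = (\<Sum>i\<le>n. (- 1) ^ n / fact m *
      real ((2 * n + 2 choose (2 * i + 1)) * tangent_number i * tangent_number (n - i)))"
    proof (rule sum.cong[OF refl])
      fix i assume "i \<in> {..n}"
      then have i: "i \<le> n" by simp
      have m': "m - (2 * i + 1) = 2 * (n - i) + 1"
        using i 3 by simp
      have sgn: "(- 1) ^ i * (- 1) ^ (n - i) = ((- 1) ^ n :: real)"
        using i by (simp flip: power_add)
      have binom: "real (2 * n + 2 choose (2 * i + 1)) =
        fact m / (fact (2 * i + 1) * fact (2 * (n - i) + 1))"
        using binomial_fact[of "2 * i + 1" m, where ?'a = real] i m' 3 by simp
      show "tanh_fps $ (2 * i + 1) * tanh_fps $ (m - (2 * i + 1)) = (- 1) ^ n / fact m *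
        real ((2 * n + 2 choose (2 * i + 1)) * tangent_number i * tangent_number (n - i))"
        unfolding m' tanh_fps_nth_odd of_nat_mult binom sgn[symmetric]
        by (simp add: field_simps del: fact_Suc)
    qed
    also have "\<dots> = (- 1) ^ n / fact m * real (tangent_number (Suc n))"
      by (simp add: sum_distrib_left)
    finally have sq: "(tanh_fps\<^sup>2) $ m = (- 1) ^ n / fact m * real (tangent_number (Suc n))" .
    have "fps_deriv tanh_fps $ m = real (m + 1) * tanh_fps $ (2 * Suc n + 1)"
      using 3 by (simp add: numeral_eq_Suc)
    also have "\<dots> = (- 1) ^ Suc n / fact m * real (tangent_number (Suc n))"
    proof -
      have "fact (2 * Suc n + 1) = real (m + 1) * fact m"
        using fact_Suc[of m, where ?'a = real] 3 by simp
      then show ?thesis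
        unfolding tanh_fps_nth_odd by (simp del: fact_Suc tangent_number.simps)
    qed
    finally show ?thesis
      using sq 3 by (simp del: tangent_number.simps)
  qed
qed

text \<open>
  The quotient \<open>u = (1 + t) / (1 - t)\<close> linearises the differential equation of \<open>t\<close>: it satisfies
  \<open>u' = 2 * u\<close> with constant term one, hence is \<open>exp (2x)\<close>.
\<close>

lemma tanh_fps_exp: "tanh_fps * (fps_exp 2 + 1) = fps_exp 2 - 1"
proof -
  let ?t = tanh_fps
  have t0: "?t $ 0 = 0"
    by (simp add: tanh_fps_nth_even)
  define u where "u = (1 + ?t) * inverse (1 - ?t)"
  have inv: "inverse (1 - ?t) * (1 - ?t) = 1"
    by (rule inverse_mult_eq_1) (simp add: t0)
  have "fps_deriv (inverse (1 - ?t)) = fps_deriv ?t * (inverse (1 - ?t))\<^sup>2"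
    by (subst fps_inverse_deriv) (simp_all add: t0)
  then have "fps_deriv u = (1 - ?t\<^sup>2) * inverse (1 - ?t) + (1 + ?t) * ((1 - ?t\<^sup>2) * (inverse (1 - ?t))\<^sup>2)"
    by (simp add: u_def fps_deriv_tanh_fps)
  also have "\<dots> = 2 * u"
    using inv unfolding u_def by algebra
  finally have "fps_deriv u = fps_const 2 * u"
    by (simp add: numeral_fps_const)
  then have "u = fps_const (u $ 0) * fps_exp 2"
    by (simp add: fps_exp_unique_ODE)
  then have "u = fps_exp 2"
    by (simp add: u_def t0)
  then have "1 + ?t = fps_exp 2 * (1 - ?t)"
    using inv unfolding u_def by (metis mult.assoc mult.right_neutral)
  then show ?thesis
    by (simp add: algebra_simps)
qed

definition bernoulli_fps :: "real \<Rightarrow> real fps" where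
  "bernoulli_fps c = Abs_fps (\<lambda>m. bernoulli m / fact m) oo (fps_const c * fps_X)"

lemma bernoulli_fps_nth: "bernoulli_fps c $ m = c ^ m * bernoulli m / fact m"
  by (simp add: bernoulli_fps_def fps_compose_linear)

lemma bernoulli_fps_mult: "bernoulli_fps c * (fps_exp c - 1) = fps_const c * fps_X"
proof -
  have "(Abs_fps (\<lambda>m. bernoulli m / fact m) * (fps_exp 1 - 1)) oo (fps_const c * fps_X) =
    fps_X oo (fps_const c * fps_X)"
    by (simp add: bernoulli_egf)
  then show ?thesis
    by (simp add: bernoulli_fps_def fps_compose_mult_distrib fps_compose_sub_distrib)
qed

text \<open>
  With \<open>E = exp (2x)\<close> one has \<open>t = 1 - 2 / (E + 1)\<close>, and the partial fractions
  \<open>1 / (E + 1) = 1 / (E - 1) - 2 / (E\<^sup>2 - 1)\<close> have denominators whose reciprocals generate Bernoulli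
  numbers.  The proof multiplies through by \<open>E\<^sup>2 - 1\<close>, which is not the zero series.
\<close>

lemma fps_X_mult_tanh_fps: "fps_X * tanh_fps = fps_X - bernoulli_fps 2 + bernoulli_fps 4"
proof -
  let ?E = "fps_exp 2 :: real fps"
  have E4: "fps_exp 4 = ?E * ?E"
    using fps_exp_add_mult[of 2 "2 :: real"] by simp
  have b2: "bernoulli_fps 2 * (?E - 1) = 2 * fps_X"
    using bernoulli_fps_mult[of 2] by (simp add: numeral_fps_const)
  have b4: "bernoulli_fps 4 * (?E * ?E - 1) = 4 * fps_X"
    using bernoulli_fps_mult[of 4] by (simp add: numeral_fps_const E4)
  have "(fps_X * tanh_fps) * (?E * ?E - 1) =
    (fps_X - bernoulli_fps 2 + bernoulli_fps 4) * (?E * ?E - 1)"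
    using tanh_fps_exp b2 b4 by algebra
  moreover have "(fps_exp 4 - 1 :: real fps) $ 1 \<noteq> 0"
    by simp
  then have "?E * ?E - 1 \<noteq> 0"
    unfolding E4 by (metis fps_zero_nth)
  ultimately show ?thesis by simp
qed

text \<open>
  Comparing coefficients leaves a sign \<open>(- 1) ^ (n - 1)\<close> on the tangent number; since tangent numbers
  are nonnegative, taking absolute values removes it.
\<close>

lemma tangent_number_bernoulli:
  assumes "n \<ge> 1"
  shows "real n * real (tangent_number (n - 1)) = real (2 ^ (2 * n) choose 2) * \<bar>bernoulli (2 * n)\<bar>"
proof -
  let ?q = "2 ^ (2 * n) :: real"
  have "(fps_X * tanh_fps) $ (2 * n) = (fps_X - bernoulli_fps 2 + bernoulli_fps 4) $ (2 * n)"
    by (simp only: fps_X_mult_tanh_fps)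
  moreover have "2 * n - 1 = 2 * (n - 1) + 1"
    using assms by simp
  moreover have "(4 :: real) ^ (2 * n) = ?q * ?q"
    by (simp flip: power_mult_distrib)
  moreover have "2 * n \<noteq> 1" by presburger
  ultimately have "tanh_fps $ (2 * (n - 1) + 1) = ?q * (?q - 1) * bernoulli (2 * n) / fact (2 * n)"
    using assms by (simp add: bernoulli_fps_nth field_simps)
  moreover have "fact (2 * n) = 2 * real n * fact (2 * (n - 1) + 1)"
    using fact_reduce[of "2 * n", where ?'a = real] assms \<open>2 * n - 1 = 2 * (n - 1) + 1\<close> by simp
  ultimately have "(- 1) ^ (n - 1) * real (tangent_number (n - 1)) / fact (2 * (n - 1) + 1) =
    ?q * (?q - 1) * bernoulli (2 * n) / (2 * real n * fact (2 * (n - 1) + 1))"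
    by (simp only: tanh_fps_nth_odd)
  moreover have "a / f = b / (2 * real n * f) \<Longrightarrow> f \<noteq> 0 \<Longrightarrow> 2 * real n * a = b" for a b f :: real
    using assms by (simp add: field_simps)
  ultimately have "2 * real n * ((- 1) ^ (n - 1) * real (tangent_number (n - 1))) =
    ?q * (?q - 1) * bernoulli (2 * n)"
    by (metis fact_nonzero)
  then have "\<bar>2 * real n * ((- 1) ^ (n - 1) * real (tangent_number (n - 1)))\<bar> =
    \<bar>?q * (?q - 1) * bernoulli (2 * n)\<bar>"
    by simp
  then have "2 * real n * real (tangent_number (n - 1)) = ?q * (?q - 1) * \<bar>bernoulli (2 * n)\<bar>"
    by (simp add: abs_mult power_abs)
  moreover have "2 * real (2 ^ (2 * n) choose 2) = ?q * (?q - 1)"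
  proof -
    have "even ((2 :: nat) ^ (2 * n) * (2 ^ (2 * n) - 1))"
      using assms by simp
    then have "2 * (2 ^ (2 * n) choose 2) = (2 :: nat) ^ (2 * n) * (2 ^ (2 * n) - 1)"
      unfolding choose_two by (rule dvd_mult_div_cancel)
    then have "real (2 * (2 ^ (2 * n) choose 2)) = real (2 ^ (2 * n) * (2 ^ (2 * n) - 1))"
      by (rule arg_cong)
    then show ?thesis using assms by (simp add: of_nat_diff)
  qed
  ultimately have "2 * real n * real (tangent_number (n - 1)) =
    2 * real (2 ^ (2 * n) choose 2) * \<bar>bernoulli (2 * n)\<bar>"
    by (simp only:)
  then show ?thesis by simp
qed

theorem mainTheorem5:
  fixes p :: nat
  assumes "p \<ge> 3"
  shows "real (construction_number (cycle_graph p)) =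
           real (2 ^ (2 * p) choose 2) * \<bar>bernoulli (2 * p)\<bar>"
  using tangent_number_bernoulli[of p] construction_number_cycle[OF assms] assms by simp

end
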